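(* Let $X$ be a complex Banach space, $\alpha\ge0$ and $T\in\mathcal{B}(X)$. Then $$A_r(T)x=(1-r)^{\alpha+1}\sum_{n=0}^\infty r^n\Delta^{-\alpha}\mathcal{T}(n)x,\qquad 0\le r<\min\{1,\tfrac{1}{r(T)}\},\ x\in X.$$ If $\gamma\ge\alpha$ and there is $C>0$ with $\|\Delta^{-\alpha}\mathcal{T}(n)\|\le Ck^{\gamma+1}(n)$ for all $n\ge1$, then there is a constant $C'>0$, independent of $r$, such that $$\|A_r(T)\|\le C'(1-r)^{-(\gamma-\alpha)},\qquad 0\le r<1.$$ In particular, if $T$ is a $(C,\alpha)$-bounded operator, then $\sup_{0\le r<1}\|A_r(T)\|<\infty$.
   Context: $\mathcal{B}(X)$ is the algebra of bounded linear operators on $X$. The Abel mean of order $r\in[0,1)$ of $T$ is $A_r(T)x=(1-r)\sum_{n=0}^\infty r^nT^nx$, $x\in X$, when the series converges. $r(T)=\lim_{n\to\infty}\|T^n\|^{1/n}$ is the spectral radius of $T$ (with $1/r(T)=\infty$ if $r(T)=0$). For $\alpha>0$, $k^\alpha(n)=\frac{\Gamma(n+\alpha)}{\Gamma(\alpha)\Gamma(n+1)}$, $n\in\mathbb{N}_0=\{0,1,2,\dots\}$; $\Delta^{-\alpha}\mathcal{T}(n)=\sum_{j=0}^nk^\alpha(n-j)T^j$ (with $T^0=I$), and for $\alpha=0$, $\Delta^0\mathcal{T}(n)=T^n$. $T$ is $(C,\alpha)$-bounded if $\sup_n\frac{1}{k^{\alpha+1}(n)}\|\Delta^{-\alpha}\mathcal{T}(n)\|<\infty$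 (for $\alpha=0$: power bounded). *)

theory Defs
  imports "HOL-Analysis.Analysis"
begin

text \<open>
  The distribution only has real Banach spaces, so complex ones are introduced as real Banach
  spaces with a compatible complex scalar multiplication.
\<close>

class complex_banach = banach +
  fixes scaleC :: "complex \<Rightarrow> 'a \<Rightarrow> 'a"  (infixr "*\<^sub>C" 75)
  assumes scaleC_add_right: "c *\<^sub>C (x + y) = c *\<^sub>C x + c *\<^sub>C y"
    and scaleC_add_left: "(c + d) *\<^sub>C x = c *\<^sub>C x + d *\<^sub>C x"
    and scaleC_scaleC: "c *\<^sub>C d *\<^sub>C x = (c * d) *\<^sub>C x"
    and scaleC_one: "1 *\<^sub>C x = x"
    and scaleR_eq_scaleC: "a *\<^sub>R x = complex_of_real a *\<^sub>C x"
    and norm_scaleC: "norm (c *\<^sub>C x) = cmod c * norm x"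

instantiation complex :: complex_banach
begin

definition scaleC_complex :: "complex \<Rightarrow> complex \<Rightarrow> complex" where
  "scaleC_complex c x = c * x"

instance
  by standard (auto simp: scaleC_complex_def algebra_simps norm_mult scaleR_conv_of_real)

end

text \<open>
  Elements of the algebra of bounded operators are represented as functions, with
  norm \<^const>\<open>onorm\<close>; powers of an operator are function iterates.
\<close>

definition bounded_clinear :: "('a::complex_banach \<Rightarrow> 'b::complex_banach) \<Rightarrow> bool" where
  "bounded_clinear f \<longleftrightarrow> bounded_linear f \<and> (\<forall>c x. f (c *\<^sub>C x) = c *\<^sub>C f x)"

definition spectral_radius :: "('a::complex_banach \<Rightarrow> 'a) \<Rightarrow> real" where
  "spectral_radius T = lim (\<lambda>n. root n (onorm (T ^^ n)))"

text \<open>Only meaningful where the series converges.\<close>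

definition abel_mean :: "real \<Rightarrow> ('a::complex_banach \<Rightarrow> 'a) \<Rightarrow> 'a \<Rightarrow> 'a" where
  "abel_mean r T x = (1 - r) *\<^sub>R (\<Sum>n. r ^ n *\<^sub>R (T ^^ n) x)"

text \<open>Only meant for \<open>\<alpha> > 0\<close>.\<close>

definition cesaro_kernel :: "real \<Rightarrow> nat \<Rightarrow> real" where
  "cesaro_kernel \<alpha> n = Gamma (real n + \<alpha>) / (Gamma \<alpha> * Gamma (real n + 1))"

definition cesaro_sum :: "real \<Rightarrow> ('a::complex_banach \<Rightarrow> 'a) \<Rightarrow> nat \<Rightarrow> 'a \<Rightarrow> 'a" where
  "cesaro_sum \<alpha> T n =
     (if \<alpha> = 0 then T ^^ n
      else (\<lambda>x. \<Sum>j\<le>n. cesaro_kernel \<alpha> (n - j) *\<^sub>R (T ^^ j) x))"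

text \<open>For \<open>\<alpha> = 0\<close> this is power boundedness, because \<open>cesaro_kernel 1 n = 1\<close>.\<close>

definition cesaro_bounded :: "real \<Rightarrow> ('a::complex_banach \<Rightarrow> 'a) \<Rightarrow> bool" where
  "cesaro_bounded \<alpha> T \<longleftrightarrow>
     bdd_above (range (\<lambda>n. 1 / cesaro_kernel (\<alpha> + 1) n * onorm (cesaro_sum \<alpha> T n)))"

end

theory Submission
  imports Defs
begin

text \<open>The generating function of the Cesaro numbers of order \<open>\<alpha>\<close> is \<open>(1 - r) powr (- \<alpha>)\<close>, so the
  summation formula is a Cauchy product. Convolving with the numbers of order \<open>- \<alpha>\<close>, which
  are also absolutely summable against \<open>r ^ n\<close> for \<open>r < 1\<close>, recovers the powers of \<open>T\<close> from their
  Cesaro sums. Hence a growth bound on the Cesaro sums alone already gives convergence of the Abel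
  means for all \<open>r < 1\<close>, and summing that bound gives their size.\<close>

section \<open>Existence of the spectral radius limit\<close>

text \<open>Fekete's lemma in multiplicative form: the limit is the infimum \<open>L\<close>. Roots
  rather than logarithms are used, since \<open>a\<close> may vanish. Given \<open>b\<close>
  slightly above \<open>L\<close>, some block length \<open>m\<close> satisfies
  \<open>a m \<le> b ^ m\<close>, and division by \<open>m\<close> with remainder spreads this to
  all \<open>n\<close>.\<close>

lemma submultiplicative_root_convergent:
  fixes a :: "nat \<Rightarrow> real"
  assumes nonneg: "\<And>n. 0 \<le> a n" and submult: "\<And>m n. a (m + n) \<le> a m * a n"
  shows "convergent (\<lambda>n. root n (a n))"
proof -
  \<comment> \<open>Index 0 is left out because \<open>root 0\<close> is 0 by convention and would
    force the infimum to be 0.\<close>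
  define L where "L = (INF n\<in>{1..}. root n (a n))"
  have bdd: "bdd_below ((\<lambda>n. root n (a n)) ` {1..})"
    by (rule bdd_belowI2[where m = 0]) (simp add: nonneg)
  have L_le: "L \<le> root n (a n)" if "n \<ge> 1" for n
    unfolding L_def by (rule cINF_lower[OF bdd]) (use that in simp)
  have L_nonneg: "0 \<le> L"
    unfolding L_def by (rule cINF_greatest) (auto simp: nonneg)
  have iter: "a (q * m + s) \<le> a m ^ q * a s" for q m s
  proof (induction q)
    case (Suc q)
    have "a (Suc q * m + s) \<le> a m * a (q * m + s)"
      using submult[of m "q * m + s"] by (simp add: add.assoc)
    also have "\<dots> \<le> a m * (a m ^ q * a s)"
      by (intro mult_left_mono Suc nonneg)
    finally show ?case by (simp add: mult.assoc)
  qed simp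
  have "(\<lambda>n. root n (a n)) \<longlonglongrightarrow> L"
  proof (rule order_tendstoI)
    fix c assume "c < L"
    then show "\<forall>\<^sub>F n in sequentially. c < root n (a n)"
      using L_le by (intro eventually_sequentiallyI[of 1]) force
  next
    fix c assume "L < c"
    \<comment> \<open>The gap between \<open>b\<close> and \<open>c\<close> will absorb the factor
      \<open>root n M\<close>, which tends to 1.\<close>
    then obtain b where b: "L < b" "b < c" using dense by blast
    then have b_pos: "0 < b" using L_nonneg by linarith
    from b(1) obtain m where m: "m \<ge> 1" "root m (a m) < b"
      unfolding L_def using cINF_less_iff[OF _ bdd, of b] by auto
    have "a m = root m (a m) ^ m" using m nonneg by simp
    also have "\<dots> \<le> b ^ m" by (intro power_mono) (use m nonneg in auto)
    finally have am: "a m \<le> b ^ m" .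
    \<comment> \<open>\<open>M\<close> dominates \<open>a s / b ^ s\<close> for all possible
      remainders \<open>s\<close> at once; the summand 1 makes it positive.\<close>
    define M where "M = 1 + (\<Sum>s<m. a s / b ^ s)"
    have M_pos: "0 < M"
      unfolding M_def using nonneg b_pos by (intro add_pos_nonneg sum_nonneg) auto
    have a_le: "a n \<le> M * b ^ n" for n
    proof -
      define q s where "q = n div m" and "s = n mod m"
      have n: "n = q * m + s" and "s < m" using m by (simp_all add: q_def s_def)
      have "a s / b ^ s \<le> (\<Sum>s<m. a s / b ^ s)"
        by (rule member_le_sum) (use \<open>s < m\<close> nonneg b_pos in auto)
      then have "a s / b ^ s \<le> M" by (simp add: M_def)
      then have as: "a s \<le> M * b ^ s" using b_pos by (simp add: field_simps)
      have "a n \<le> a m ^ q * a s" unfolding n by (rule iter)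
      also have "\<dots> \<le> (b ^ m) ^ q * (M * b ^ s)"
        by (intro mult_mono power_mono am as nonneg) (use b_pos in auto)
      also have "\<dots> = M * b ^ n"
        by (simp add: n power_add power_mult mult.commute[of q m])
      finally show ?thesis .
    qed
    have "(\<lambda>n. root n M * b) \<longlonglongrightarrow> 1 * b"
      by (intro tendsto_intros LIMSEQ_root_const M_pos)
    then have "\<forall>\<^sub>F n in sequentially. root n M * b < c"
      using b(2) by (auto dest: order_tendstoD(2))
    then show "\<forall>\<^sub>F n in sequentially. root n (a n) < c"
      using eventually_ge_at_top[of 1]
    proof eventually_elim
      case (elim n)
      have "root n (a n) \<le> root n (M * b ^ n)"
        using a_le elim by simp
      also have "\<dots> = root n M * b"
        using elim b_pos by (simp add: real_root_mult real_root_power_cancel)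
      finally show ?case using elim by simp
    qed
  qed
  then show ?thesis by (rule convergentI)
qed

lemma bounded_linear_funpow: "bounded_linear (T ^^ n)" if "bounded_linear T"
  for T :: "'a::real_normed_vector \<Rightarrow> 'a"
proof (induction n)
  case (Suc n)
  then show ?case
    using bounded_linear_compose[OF that] by (simp add: o_def)
qed (simp add: id_def)

text \<open>Operator norms of iterates are submultiplicative, so the \<open>lim\<close> in the
  definition is a genuine limit.\<close>

lemma spectral_radius_LIMSEQ:
  assumes "bounded_linear T"
  shows "(\<lambda>n. root n (onorm (T ^^ n))) \<longlonglongrightarrow> spectral_radius T"
  unfolding spectral_radius_def convergent_LIMSEQ_iff[symmetric]
  by (rule submultiplicative_root_convergent)
    (auto simp: funpow_add intro!: onorm_compose onorm_pos_le bounded_linear_funpow assms)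

lemma summable_power_onorm_funpow:
  assumes T: "bounded_linear T" and r: "0 \<le> r" "ereal r < 1 / ereal (spectral_radius T)"
  shows "summable (\<lambda>n. r ^ n * onorm (T ^^ n))"
proof (rule root_test_convergence)
  let ?R = "spectral_radius T"
  have pos: "0 \<le> onorm (T ^^ n)" for n
    by (intro onorm_pos_le bounded_linear_funpow T)
  have "(\<lambda>n. r * root n (onorm (T ^^ n))) \<longlonglongrightarrow> r * ?R"
    by (intro tendsto_intros spectral_radius_LIMSEQ T)
  moreover have "\<forall>\<^sub>F n in sequentially.
      r * root n (onorm (T ^^ n)) = root n (norm (r ^ n * onorm (T ^^ n)))"
    using eventually_ge_at_top[of 1]
    by eventually_elim
      (use r pos in \<open>simp add: real_root_mult real_root_power_cancel abs_mult power_abs\<close>)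
  ultimately show "(\<lambda>n. root n (norm (r ^ n * onorm (T ^^ n)))) \<longlonglongrightarrow> r * ?R"
    by (rule Lim_transform_eventually)
  \<comment> \<open>For positive \<open>?R\<close> the hypothesis on \<open>r\<close> can be
    multiplied out. For \<open>?R = 0\<close> the bound on \<open>r\<close> is infinite in
    \<open>ereal\<close>, but then the product is 0.\<close>
  have "0 \<le> ?R"
    by (rule LIMSEQ_le_const[OF spectral_radius_LIMSEQ[OF T]]) (auto intro!: real_root_ge_zero pos)
  then show "r * ?R < 1"
  proof (cases "?R = 0")
    case False
    with \<open>0 \<le> ?R\<close> r(2) show ?thesis
      by (simp add: one_ereal_def field_simps)
  qed simp
qed

section \<open>Convolution of a scalar and a vector sequence\<close>

text \<open>The convolution is dominated by that of the norms, which is summable by the scalar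
  Cauchy product.\<close>

lemma summable_norm_Cauchy_product_scaleR:
  fixes a :: "nat \<Rightarrow> real" and b :: "nat \<Rightarrow> 'a::real_normed_vector"
  assumes a: "summable (\<lambda>k. norm (a k))" and b: "summable (\<lambda>k. norm (b k))"
  shows "summable (\<lambda>k. norm (\<Sum>i\<le>k. a i *\<^sub>R b (k - i)))"
proof (rule summable_comparison_test')
  show "summable (\<lambda>k. \<Sum>i\<le>k. norm (a i) * norm (b (k - i)))"
    using Cauchy_product_sums[of "\<lambda>k. norm (a k)" "\<lambda>k. norm (b k)"] a b
    by (auto simp: sums_iff)
  show "norm (norm (\<Sum>i\<le>k. a i *\<^sub>R b (k - i))) \<le> (\<Sum>i\<le>k. norm (a i) * norm (b (k - i)))" for k
    by (auto intro!: sum_norm_le)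
qed

text \<open>The difference between the square and the triangular partial sums is dominated by the same
  difference for the norms, which vanishes in the limit by the scalar Cauchy product theorem.\<close>

lemma Cauchy_product_scaleR_sums:
  fixes a :: "nat \<Rightarrow> real" and b :: "nat \<Rightarrow> 'a::banach"
  assumes a: "summable (\<lambda>k. norm (a k))" and b: "summable (\<lambda>k. norm (b k))"
  shows "(\<lambda>k. \<Sum>i\<le>k. a i *\<^sub>R b (k - i)) sums ((\<Sum>k. a k) *\<^sub>R (\<Sum>k. b k))"
proof -
  let ?S = "\<lambda>n::nat. {..<n} \<times> {..<n}" and ?D = "\<lambda>n::nat. {(i, j). i + j < n}"
  let ?g = "\<lambda>(i, j). a i *\<^sub>R b j" and ?f = "\<lambda>(i, j). norm (a i) * norm (b j)"
  have sub: "?D n \<subseteq> ?S n" for n by auto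
  have sq: "(\<lambda>n. sum ?g (?S n)) \<longlonglongrightarrow> (\<Sum>k. a k) *\<^sub>R (\<Sum>k. b k)"
  proof -
    have "(\<lambda>n. (\<Sum>k<n. a k) *\<^sub>R (\<Sum>k<n. b k)) \<longlonglongrightarrow> (\<Sum>k. a k) *\<^sub>R (\<Sum>k. b k)"
      by (intro tendsto_scaleR summable_LIMSEQ summable_norm_cancel[OF a] summable_norm_cancel[OF b])
    moreover have "(\<Sum>k<n. a k) *\<^sub>R (\<Sum>k<n. b k) = sum ?g (?S n)" for n
      by (simp only: scaleR_sum_left) (simp only: scaleR_sum_right sum.cartesian_product)
    ultimately show ?thesis by simp
  qed
  have f_sq: "(\<lambda>n. sum ?f (?S n)) \<longlonglongrightarrow> (\<Sum>k. norm (a k)) * (\<Sum>k. norm (b k))"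
  proof -
    have "(\<lambda>n. (\<Sum>k<n. norm (a k)) * (\<Sum>k<n. norm (b k))) \<longlonglongrightarrow> (\<Sum>k. norm (a k)) * (\<Sum>k. norm (b k))"
      by (intro tendsto_mult summable_LIMSEQ a b)
    then show ?thesis by (simp add: sum_product sum.cartesian_product)
  qed
  have f_tri: "(\<lambda>n. sum ?f (?D n)) \<longlonglongrightarrow> (\<Sum>k. norm (a k)) * (\<Sum>k. norm (b k))"
    using Cauchy_product_sums[of "\<lambda>k. norm (a k)" "\<lambda>k. norm (b k)"] a b
    by (simp add: sums_def sum.triangle_reindex)
  have lim: "(\<lambda>n. sum ?f (?S n) - sum ?f (?D n)) \<longlonglongrightarrow> 0"
    using tendsto_diff[OF f_sq f_tri] by simp
  have "norm (sum ?g (?S n) - sum ?g (?D n)) \<le> sum ?f (?S n) - sum ?f (?D n)" for n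
  proof -
    have "norm (sum ?g (?S n - ?D n)) \<le> sum ?f (?S n - ?D n)"
      by (rule sum_norm_le) auto
    then show ?thesis
      by (simp only: sum_diff[OF finite_cartesian_product[OF finite_lessThan finite_lessThan] sub])
  qed
  then have "(\<lambda>n. sum ?g (?S n) - sum ?g (?D n)) \<longlonglongrightarrow> 0"
    by (intro Lim_null_comparison[OF _ lim] always_eventually allI)
  from tendsto_diff[OF sq this] show ?thesis
    by (simp add: sums_def sum.triangle_reindex)
qed

text \<open>Both sides add \<open>(p i * q j) *\<^sub>R v k\<close> over all
  \<open>i + j + k = n\<close>, grouped differently.\<close>

lemma convolution_scaleR_assoc:
  fixes p q :: "nat \<Rightarrow> real" and v :: "nat \<Rightarrow> 'a::real_vector"
  shows "(\<Sum>i\<le>n. p i *\<^sub>R (\<Sum>j\<le>n - i. q j *\<^sub>R v (n - i - j))) =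
    (\<Sum>k\<le>n. (\<Sum>i\<le>k. p i * q (k - i)) *\<^sub>R v (n - k))"
  using fps_mult_assoc_lemma[of "\<lambda>i j k. (p i * q j) *\<^sub>R v k" n n]
  by (simp add: atLeast0AtMost scaleR_sum_left scaleR_sum_right)

section \<open>Binomial coefficients and Cesaro sums\<close>

text \<open>This agrees with \<^const>\<open>cesaro_kernel\<close> for positive order, and is also meaningful for
  nonpositive order: \<open>binomial_kernel (- \<alpha>)\<close> is the convolution inverse of \<open>binomial_kernel \<alpha>\<close>.\<close>

definition binomial_kernel :: "real \<Rightarrow> nat \<Rightarrow> real" where
  "binomial_kernel \<alpha> n = pochhammer \<alpha> n / fact n"

lemma cesaro_kernel_eq_binomial_kernel:
  assumes "\<alpha> > 0"
  shows "cesaro_kernel \<alpha> n = binomial_kernel \<alpha> n"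
proof -
  have "\<alpha> \<notin> \<int>\<^sub>\<le>\<^sub>0" using assms nonpos_Ints_nonpos by fastforce
  then show ?thesis
    using Gamma_fact[of n, where 'a = real]
    by (simp add: cesaro_kernel_def binomial_kernel_def pochhammer_Gamma add.commute)
qed

lemma binomial_kernel_0_right [simp]: "binomial_kernel \<alpha> 0 = 1"
  by (simp add: binomial_kernel_def)

lemma binomial_kernel_0_left: "binomial_kernel 0 n = (if n = 0 then 1 else 0)"
  by (simp add: binomial_kernel_def pochhammer_0_left)

lemma binomial_kernel_nonneg: "0 \<le> \<alpha> \<Longrightarrow> 0 \<le> binomial_kernel \<alpha> n"
  by (simp add: binomial_kernel_def pochhammer_prod prod_nonneg)

text \<open>Puts the terms in the form of Newton's binomial series with exponent -\<alpha> at -r;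
  the two alternating signs cancel.\<close>

lemma binomial_kernel_power_eq:
  "binomial_kernel \<alpha> n * r ^ n = ((- \<alpha>) gchoose n) * (- r) ^ n"
proof -
  have "(- 1) ^ n * (- r) ^ n = r ^ n"
    by (simp flip: power_mult_distrib)
  then show ?thesis
    by (simp add: binomial_kernel_def gbinomial_pochhammer)
qed

lemma binomial_kernel_sums:
  assumes "\<bar>r\<bar> < 1"
  shows "(\<lambda>n. binomial_kernel \<alpha> n * r ^ n) sums (1 - r) powr (- \<alpha>)"
  using gen_binomial_real[of "- r" "- \<alpha>"] assms by (simp add: binomial_kernel_power_eq)

text \<open>A power series converging at the midpoint of \<open>r\<close> and 1 converges absolutely
  at \<open>r\<close>. This covers negative orders too, where the coefficients change sign.\<close>

lemma summable_norm_binomial_kernel: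
  assumes "0 \<le> r" "r < 1"
  shows "summable (\<lambda>n. norm (binomial_kernel \<alpha> n * r ^ n))"
  by (rule powser_insidea[of _ "(1 + r) / 2"])
    (use assms binomial_kernel_sums[of "(1 + r) / 2" \<alpha>] in \<open>auto simp: sums_iff\<close>)

text \<open>The Chu-Vandermonde identity for rising factorials, divided by
  \<open>fact n\<close>.\<close>

lemma binomial_kernel_convolution:
  "(\<Sum>i\<le>n. binomial_kernel \<alpha> i * binomial_kernel \<beta> (n - i)) = binomial_kernel (\<alpha> + \<beta>) n"
proof -
  have "(\<Sum>i\<le>n. binomial_kernel \<alpha> i * binomial_kernel \<beta> (n - i)) =
      (\<Sum>i\<le>n. real (n choose i) * pochhammer \<alpha> i * pochhammer \<beta> (n - i)) / fact n"
    unfolding sum_divide_distrib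
    by (rule sum.cong) (auto simp: binomial_kernel_def binomial_fact field_simps)
  then show ?thesis
    by (simp add: binomial_kernel_def flip: pochhammer_binomial_sum)
qed

text \<open>Merges the two cases of the definition: the kernel of order 0 is the unit of
  convolution, so it returns \<open>T ^^ n\<close> itself.\<close>

lemma cesaro_sum_eq:
  assumes "\<alpha> \<ge> 0"
  shows "cesaro_sum \<alpha> T n x = (\<Sum>i\<le>n. binomial_kernel \<alpha> i *\<^sub>R (T ^^ (n - i)) x)"
proof (cases "\<alpha> = 0")
  case True
  have "(\<Sum>i\<le>n. binomial_kernel 0 i *\<^sub>R (T ^^ (n - i)) x) =
      (\<Sum>i\<in>{0}. binomial_kernel 0 i *\<^sub>R (T ^^ (n - i)) x)"
    by (rule sum.mono_neutral_right) (auto simp: binomial_kernel_0_left)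
  with True show ?thesis by (simp add: cesaro_sum_def)
next
  case False
  have "(\<Sum>j\<le>n. cesaro_kernel \<alpha> (n - j) *\<^sub>R (T ^^ j) x) =
      (\<Sum>i\<le>n. cesaro_kernel \<alpha> i *\<^sub>R (T ^^ (n - i)) x)"
    by (rule sum.reindex_bij_witness[of _ "\<lambda>i. n - i" "\<lambda>i. n - i"]) auto
  with False assms show ?thesis
    by (simp add: cesaro_sum_def cesaro_kernel_eq_binomial_kernel)
qed

text \<open>By associativity the kernels of orders -\<alpha> and \<alpha> combine to the one of
  order 0.\<close>

lemma cesaro_sum_inversion:
  assumes "\<alpha> \<ge> 0"
  shows "(T ^^ n) x = (\<Sum>i\<le>n. binomial_kernel (- \<alpha>) i *\<^sub>R cesaro_sum \<alpha> T (n - i) x)"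
proof -
  have "(\<Sum>i\<le>n. binomial_kernel (- \<alpha>) i *\<^sub>R cesaro_sum \<alpha> T (n - i) x) =
      (\<Sum>k\<le>n. binomial_kernel 0 k *\<^sub>R (T ^^ (n - k)) x)"
    using convolution_scaleR_assoc[of "binomial_kernel (- \<alpha>)" "binomial_kernel \<alpha>" "\<lambda>j. (T ^^ j) x" n]
    by (simp add: cesaro_sum_eq[OF assms] binomial_kernel_convolution)
  also have "\<dots> = (T ^^ n) x"
    using cesaro_sum_eq[of 0 T n x] by (simp add: cesaro_sum_def)
  finally show ?thesis by simp
qed

lemma bounded_linear_cesaro_sum:
  assumes "bounded_linear T"
  shows "bounded_linear (cesaro_sum \<alpha> T n)"
  unfolding cesaro_sum_def
  by (auto intro!: bounded_linear_sum bounded_linear_const_scaleR bounded_linear_funpow assms)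

section \<open>Abel means\<close>

text \<open>Splitting \<open>r ^ n\<close> as \<open>r ^ i * r ^ (n - i)\<close> turns a weighted
  convolution into a convolution of weighted sequences, as the Cauchy product requires.\<close>

lemma power_scaleR_convolution:
  fixes v :: "nat \<Rightarrow> 'a::real_vector"
  shows "r ^ n *\<^sub>R (\<Sum>i\<le>n. p i *\<^sub>R v (n - i)) =
    (\<Sum>i\<le>n. (p i * r ^ i) *\<^sub>R (r ^ (n - i) *\<^sub>R v (n - i)))"
  unfolding scaleR_sum_right
  by (rule sum.cong) (auto simp: mult_ac simp flip: power_add)

lemma summable_norm_power_cesaro_sum:
  assumes "\<alpha> \<ge> 0" "0 \<le> r" "r < 1" "summable (\<lambda>n. norm (r ^ n *\<^sub>R (T ^^ n) x))"
  shows "summable (\<lambda>n. norm (r ^ n *\<^sub>R cesaro_sum \<alpha> T n x))"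
  unfolding cesaro_sum_eq[OF assms(1)] power_scaleR_convolution[of r _ _ "\<lambda>j. (T ^^ j) x"]
  by (intro summable_norm_Cauchy_product_scaleR summable_norm_binomial_kernel assms)

lemma summable_norm_power_funpow:
  assumes "\<alpha> \<ge> 0" "0 \<le> r" "r < 1" "summable (\<lambda>n. norm (r ^ n *\<^sub>R cesaro_sum \<alpha> T n x))"
  shows "summable (\<lambda>n. norm (r ^ n *\<^sub>R (T ^^ n) x))"
  unfolding cesaro_sum_inversion[OF assms(1), where T = T]
    power_scaleR_convolution[of r _ _ "\<lambda>j. cesaro_sum \<alpha> T j x"]
  by (intro summable_norm_Cauchy_product_scaleR summable_norm_binomial_kernel assms)

text \<open>The Cesaro series is \<open>(1 - r) powr (- \<alpha>)\<close> times the power series of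
  \<open>T\<close>, and the prefactor reduces this to \<open>1 - r\<close>.\<close>

lemma abel_mean_eq_cesaro_sum:
  assumes "\<alpha> \<ge> 0" "0 \<le> r" "r < 1" "summable (\<lambda>n. norm (r ^ n *\<^sub>R (T ^^ n) x))"
  shows "abel_mean r T x = (1 - r) powr (\<alpha> + 1) *\<^sub>R (\<Sum>n. r ^ n *\<^sub>R cesaro_sum \<alpha> T n x)"
proof -
  have "(\<Sum>n. r ^ n *\<^sub>R cesaro_sum \<alpha> T n x) =
      (\<Sum>n. binomial_kernel \<alpha> n * r ^ n) *\<^sub>R (\<Sum>n. r ^ n *\<^sub>R (T ^^ n) x)"
    unfolding cesaro_sum_eq[OF assms(1)] power_scaleR_convolution[of r _ _ "\<lambda>j. (T ^^ j) x"]
    by (intro sums_unique[symmetric] Cauchy_product_scaleR_sums summable_norm_binomial_kernel assms)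
  also have "(\<Sum>n. binomial_kernel \<alpha> n * r ^ n) = (1 - r) powr (- \<alpha>)"
    using binomial_kernel_sums[of r \<alpha>] assms by (simp add: sums_iff)
  finally show ?thesis
    using assms by (simp add: abel_mean_def flip: powr_add)
qed

text \<open>Continuity of complex scaling allows it to be pulled out of an infinite series.\<close>

lemma bounded_linear_scaleC: "bounded_linear (\<lambda>x::'a::complex_banach. c *\<^sub>C x)"
  by (rule bounded_linear_intro[where K = "cmod c"])
    (simp_all add: scaleC_add_right scaleR_eq_scaleC scaleC_scaleC norm_scaleC mult.commute)

lemma funpow_scaleC:
  fixes T :: "'a::complex_banach \<Rightarrow> 'a"
  assumes "bounded_clinear T"
  shows "(T ^^ n) (c *\<^sub>C x) = c *\<^sub>C (T ^^ n) x"
  using assms by (induction n) (auto simp: bounded_clinear_def)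

text \<open>Additivity and homogeneity pass termwise to the convergent series; the bound with
  \<open>K\<close> is assumed because the growth estimate supplies it.\<close>

lemma bounded_clinear_abel_mean:
  assumes T: "bounded_clinear T"
    and summable: "\<And>x. summable (\<lambda>n. r ^ n *\<^sub>R (T ^^ n) x)"
    and bound: "\<And>x. norm (abel_mean r T x) \<le> K * norm x"
  shows "bounded_clinear (abel_mean r T)"
proof -
  have lin: "linear (T ^^ n)" for n
    using T by (auto simp: bounded_clinear_def intro!: bounded_linear.linear bounded_linear_funpow)
  have add: "abel_mean r T (x + y) = abel_mean r T x + abel_mean r T y" for x y
    by (simp add: abel_mean_def linear_add[OF lin] scaleR_add_right summable suminf_add[symmetric])
  have scaleC: "abel_mean r T (c *\<^sub>C x) = c *\<^sub>C abel_mean r T x" for c x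
  proof -
    have "(\<Sum>n. r ^ n *\<^sub>R (T ^^ n) (c *\<^sub>C x)) = (\<Sum>n. c *\<^sub>C (r ^ n *\<^sub>R (T ^^ n) x))"
      by (simp add: funpow_scaleC[OF T] scaleR_eq_scaleC scaleC_scaleC mult.commute)
    also have "\<dots> = c *\<^sub>C (\<Sum>n. r ^ n *\<^sub>R (T ^^ n) x)"
      by (rule bounded_linear.suminf[OF bounded_linear_scaleC summable, symmetric])
    finally show ?thesis
      by (simp add: abel_mean_def scaleR_eq_scaleC scaleC_scaleC mult.commute)
  qed
  have "bounded_linear (abel_mean r T)"
    by (rule bounded_linear_intro[where K = K])
      (use bound in \<open>simp_all add: add scaleC scaleR_eq_scaleC mult.commute\<close>)
  with scaleC show ?thesis by (simp add: bounded_clinear_def)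
qed

text \<open>Summing the growth bound against \<open>r ^ n\<close> gives
  \<open>(1 - r) powr (- (\<gamma> + 1))\<close>, and the factor
  \<open>(1 - r) powr (\<alpha> + 1)\<close> leaves the exponent -(\<gamma> - \<alpha>).\<close>

lemma abel_mean_growth:
  assumes T: "bounded_clinear T" and \<alpha>: "\<alpha> \<ge> 0" and \<gamma>: "\<gamma> \<ge> \<alpha>" and C: "C > 0"
    and growth: "\<And>n. n \<ge> 1 \<Longrightarrow> onorm (cesaro_sum \<alpha> T n) \<le> C * cesaro_kernel (\<gamma> + 1) n"
    and r: "0 \<le> r" "r < 1"
  shows "summable (\<lambda>n. r ^ n *\<^sub>R (T ^^ n) x)"
    and "bounded_clinear (abel_mean r T)"
    and "onorm (abel_mean r T) \<le> (C + 1) * (1 - r) powr (- (\<gamma> - \<alpha>))"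
proof -
  have lin: "bounded_linear T" using T by (simp add: bounded_clinear_def)
  \<comment> \<open>The growth hypothesis starts at n = 1. At n = 0 the Cesaro sum is the identity
    and the kernel is 1, which \<open>C + 1\<close> covers.\<close>
  let ?b = "\<lambda>x n. (C + 1) * norm x * (binomial_kernel (\<gamma> + 1) n * r ^ n)"
  have norm_le: "norm (r ^ n *\<^sub>R cesaro_sum \<alpha> T n x) \<le> ?b x n" for n x
  proof -
    have "norm (cesaro_sum \<alpha> T n x) \<le> (C + 1) * binomial_kernel (\<gamma> + 1) n * norm x"
    proof (cases "n = 0")
      case True
      then show ?thesis using C mult_right_mono[of 1 "C + 1" "norm x"] by (simp add: cesaro_sum_eq[OF \<alpha>])
    next
      case False
      have "norm (cesaro_sum \<alpha> T n x) \<le> onorm (cesaro_sum \<alpha> T n) * norm x"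
        by (rule onorm[OF bounded_linear_cesaro_sum[OF lin]])
      also have "\<dots> \<le> (C * binomial_kernel (\<gamma> + 1) n) * norm x"
        using growth[of n] False \<alpha> \<gamma>
        by (intro mult_right_mono) (simp_all add: cesaro_kernel_eq_binomial_kernel)
      also have "\<dots> \<le> (C + 1) * binomial_kernel (\<gamma> + 1) n * norm x"
        using binomial_kernel_nonneg[of "\<gamma> + 1" n] \<alpha> \<gamma> by (intro mult_right_mono) auto
      finally show ?thesis .
    qed
    from mult_left_mono[OF this, of "r ^ n"] show ?thesis
      using r by (simp add: mult_ac)
  qed
  have b_sums: "?b x sums ((C + 1) * norm x * (1 - r) powr (- (\<gamma> + 1)))" for x
    using r by (intro sums_mult binomial_kernel_sums) auto
  have sum_cesaro: "summable (\<lambda>n. norm (r ^ n *\<^sub>R cesaro_sum \<alpha> T n x))" for x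
    by (rule summable_comparison_test'[OF sums_summable[OF b_sums[of x]], of 0])
      (simp only: real_norm_def abs_norm_cancel norm_le)
  \<comment> \<open>Inversion gives convergence of the Abel series, without which the summation
    formula could not be applied below.\<close>
  then have sum_T: "summable (\<lambda>n. norm (r ^ n *\<^sub>R (T ^^ n) x))" for x
    using summable_norm_power_funpow[OF \<alpha> r] by blast
  show summable: "summable (\<lambda>n. r ^ n *\<^sub>R (T ^^ n) x)" for x
    by (rule summable_norm_cancel[OF sum_T])
  have bound: "norm (abel_mean r T x) \<le> (C + 1) * (1 - r) powr (- (\<gamma> - \<alpha>)) * norm x" for x
  proof -
    have "norm (\<Sum>n. r ^ n *\<^sub>R cesaro_sum \<alpha> T n x) \<le> (\<Sum>n. ?b x n)"
      by (rule norm_suminf_le[OF norm_le sums_summable[OF b_sums]])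
    also have "\<dots> = (C + 1) * norm x * (1 - r) powr (- (\<gamma> + 1))"
      using b_sums by (rule sums_unique[symmetric])
    finally have "norm (abel_mean r T x) \<le>
        (1 - r) powr (\<alpha> + 1) * ((C + 1) * norm x * (1 - r) powr (- (\<gamma> + 1)))"
      by (simp add: abel_mean_eq_cesaro_sum[OF \<alpha> r sum_T] mult_left_mono)
    also have "\<dots> = (C + 1) * ((1 - r) powr (\<alpha> + 1) * (1 - r) powr (- (\<gamma> + 1))) * norm x"
      by (simp only: mult_ac)
    also have "\<dots> = (C + 1) * (1 - r) powr (- (\<gamma> - \<alpha>)) * norm x"
      by (simp flip: powr_add)
    finally show ?thesis .
  qed
  show "bounded_clinear (abel_mean r T)"
    by (rule bounded_clinear_abel_mean[OF T summable bound])
  show "onorm (abel_mean r T) \<le> (C + 1) * (1 - r) powr (- (\<gamma> - \<alpha>))"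
    by (rule onorm_bound[OF _ bound]) (use C in simp)
qed

lemma cesaro_bounded_imp_growth:
  assumes "cesaro_bounded \<alpha> T" "\<alpha> \<ge> 0"
  obtains C where "C > 0" "\<And>n. onorm (cesaro_sum \<alpha> T n) \<le> C * cesaro_kernel (\<alpha> + 1) n"
proof -
  from assms(1) obtain M
    where M: "1 / cesaro_kernel (\<alpha> + 1) n * onorm (cesaro_sum \<alpha> T n) \<le> M" for n
    by (auto simp: cesaro_bounded_def bdd_above_def)
  \<comment> \<open>\<open>\<bar>M\<bar> + 1\<close> is a bound that is certainly positive, as the
    growth condition demands.\<close>
  have "onorm (cesaro_sum \<alpha> T n) \<le> (\<bar>M\<bar> + 1) * cesaro_kernel (\<alpha> + 1) n" for n
  proof -
    have pos: "0 < cesaro_kernel (\<alpha> + 1) n"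
      using assms(2) by (simp add: cesaro_kernel_eq_binomial_kernel binomial_kernel_def pochhammer_pos)
    have "onorm (cesaro_sum \<alpha> T n) \<le> M * cesaro_kernel (\<alpha> + 1) n"
      using M[of n] pos by (simp add: field_simps)
    also have "\<dots> \<le> (\<bar>M\<bar> + 1) * cesaro_kernel (\<alpha> + 1) n"
      using pos by (intro mult_right_mono) auto
    finally show ?thesis .
  qed
  then show thesis by (intro that[of "\<bar>M\<bar> + 1"]) auto
qed

theorem theorem1:
  fixes T :: "'a::complex_banach \<Rightarrow> 'a" and \<alpha> :: real
  assumes "bounded_clinear T" and "\<alpha> \<ge> 0"
  shows "(\<forall>r x. 0 \<le> r \<and> ereal r < min 1 (1 / ereal (spectral_radius T)) \<longrightarrow>
            summable (\<lambda>n. r ^ n *\<^sub>R (T ^^ n) x) \<and>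
            summable (\<lambda>n. r ^ n *\<^sub>R cesaro_sum \<alpha> T n x) \<and>
            abel_mean r T x = (1 - r) powr (\<alpha> + 1) *\<^sub>R (\<Sum>n. r ^ n *\<^sub>R cesaro_sum \<alpha> T n x))
       \<and> (\<forall>\<gamma>\<ge>\<alpha>. (\<exists>C>0. \<forall>n\<ge>1. onorm (cesaro_sum \<alpha> T n) \<le> C * cesaro_kernel (\<gamma> + 1) n) \<longrightarrow>
            (\<exists>C'>0. \<forall>r. 0 \<le> r \<and> r < 1 \<longrightarrow>
               (\<forall>x. summable (\<lambda>n. r ^ n *\<^sub>R (T ^^ n) x)) \<and>
               bounded_clinear (abel_mean r T) \<and>
               onorm (abel_mean r T) \<le> C' * (1 - r) powr (- (\<gamma> - \<alpha>))))
       \<and> (cesaro_bounded \<alpha> T \<longrightarrow>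
            (\<forall>r. 0 \<le> r \<and> r < 1 \<longrightarrow>
               (\<forall>x. summable (\<lambda>n. r ^ n *\<^sub>R (T ^^ n) x)) \<and> bounded_clinear (abel_mean r T)) \<and>
            bdd_above ((\<lambda>r. onorm (abel_mean r T)) ` {0..<1}))"
proof (intro conjI allI impI)
  fix r x
  assume asm: "0 \<le> r \<and> ereal r < min 1 (1 / ereal (spectral_radius T))"
  then have r: "0 \<le> r" "r < 1" "ereal r < 1 / ereal (spectral_radius T)" by auto
  have lin: "bounded_linear T" using assms(1) by (simp add: bounded_clinear_def)
  have T: "summable (\<lambda>n. norm (r ^ n *\<^sub>R (T ^^ n) x))"
  proof (rule summable_comparison_test')
    show "summable (\<lambda>n. r ^ n * onorm (T ^^ n) * norm x)"
      by (intro summable_mult2 summable_power_onorm_funpow lin r)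
    show "norm (norm (r ^ n *\<^sub>R (T ^^ n) x)) \<le> r ^ n * onorm (T ^^ n) * norm x" for n
      using r onorm[OF bounded_linear_funpow[OF lin], of n x]
      by (simp add: mult.assoc mult_left_mono)
  qed
  then show "summable (\<lambda>n. r ^ n *\<^sub>R (T ^^ n) x)" by (rule summable_norm_cancel)
  show "summable (\<lambda>n. r ^ n *\<^sub>R cesaro_sum \<alpha> T n x)"
    by (rule summable_norm_cancel[OF summable_norm_power_cesaro_sum[OF assms(2) r(1,2) T]])
  show "abel_mean r T x = (1 - r) powr (\<alpha> + 1) *\<^sub>R (\<Sum>n. r ^ n *\<^sub>R cesaro_sum \<alpha> T n x)"
    by (rule abel_mean_eq_cesaro_sum[OF assms(2) r(1,2) T])
next
  fix \<gamma>
  assume \<gamma>: "\<alpha> \<le> \<gamma>"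
    and "\<exists>C>0. \<forall>n\<ge>1. onorm (cesaro_sum \<alpha> T n) \<le> C * cesaro_kernel (\<gamma> + 1) n"
  then obtain C where "C > 0"
    "\<And>n. n \<ge> 1 \<Longrightarrow> onorm (cesaro_sum \<alpha> T n) \<le> C * cesaro_kernel (\<gamma> + 1) n"
    by blast
  note * = abel_mean_growth[OF assms \<gamma> this]
  show "\<exists>C'>0. \<forall>r. 0 \<le> r \<and> r < 1 \<longrightarrow>
      (\<forall>x. summable (\<lambda>n. r ^ n *\<^sub>R (T ^^ n) x)) \<and> bounded_clinear (abel_mean r T) \<and>
      onorm (abel_mean r T) \<le> C' * (1 - r) powr (- (\<gamma> - \<alpha>))"
    by (rule exI[of _ "C + 1"]) (use \<open>C > 0\<close> * in auto)
next
  assume "cesaro_bounded \<alpha> T"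
  then obtain C where "C > 0" "\<And>n. onorm (cesaro_sum \<alpha> T n) \<le> C * cesaro_kernel (\<alpha> + 1) n"
    using cesaro_bounded_imp_growth assms(2) by blast
  \<comment> \<open>With \<gamma> = \<alpha> the power of \<open>1 - r\<close> is 1, so
    \<open>C + 1\<close> bounds the norms uniformly in \<open>r\<close>.\<close>
  note * = abel_mean_growth[OF assms order_refl this]
  show "summable (\<lambda>n. r ^ n *\<^sub>R (T ^^ n) x)" and "bounded_clinear (abel_mean r T)"
    if "0 \<le> r \<and> r < 1" for r x
    using that *(1,2) by auto
  show "bdd_above ((\<lambda>r. onorm (abel_mean r T)) ` {0..<1})"
    by (rule bdd_aboveI2[where M = "C + 1"]) (use *(3) in force)
qed

end
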